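(* Fix $\alpha>0$ and let $X=\{(\lambda,m_\lambda)\}_{\lambda\in\Lambda}$ be a divisor. If there exists a compact subset $K$ of $\mathbb C$ such that $$\bigcup_{\lambda\in\Lambda} D(\lambda,\sqrt{m_\lambda/\alpha})=\mathbb C\setminus K,$$ then $X$ is not a zero divisor for $\mathcal F^\infty_\alpha$.
   Context: $D(z,r)$ is the open disc of radius $r$ centered at $z\in\mathbb C$. For $\alpha>0$, $\mathcal F^\infty_\alpha$ is the Banach space of entire functions $f$ with $\sup_{z\in\mathbb C}|f(z)|e^{-\frac{\alpha}{2}|z|^2}<\infty$. A divisor is $X=\{(\lambda,m_\lambda)\}_{\lambda\in\Lambda}$, where $\Lambda$ is a sequence of (distinct) points in $\mathbb C$ and $m_\lambda\in\{1,2,3,\dots\}$ is the multiplicity associated with $\lambda$. Put $N^\infty_{\lambda,m_\lambda}=\{f\in\mathcal F^\infty_\alpha: f(\lambda)=f'(\lambda)=\dots=f^{(m_\lambda-1)}(\lambda)=0\}$. $X$ is a zero divisor for $\mathcal F^\infty_\alpha$ if $\bigcap_{\lambda\in\Lambda}N^\infty_{\lambda,m_\lambda}\ne\{0\}$. *)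

theory Defs
  imports "HOL-Complex_Analysis.Complex_Analysis"
begin

definition fock_infinity :: "real \<Rightarrow> (complex \<Rightarrow> complex) set" where
  "fock_infinity \<alpha> =
     {f. f holomorphic_on UNIV \<and>
         bdd_above (range (\<lambda>z. norm (f z) * exp (- (\<alpha> / 2) * (norm z)\<^sup>2)))}"

(* A divisor is the set of its pairs (point, multiplicity).  The points are distinct, so
   each occurs in exactly one pair (single_valued); they form a finite or infinite
   sequence, hence countability.  Accumulation points are not excluded. *)
definition divisor :: "(complex \<times> nat) set \<Rightarrow> bool" where
  "divisor X \<longleftrightarrow> countable X \<and> single_valued X \<and> (\<forall>(l, m) \<in> X. 1 \<le> m)"

definition vanishing_subspace :: "real \<Rightarrow> complex \<Rightarrow> nat \<Rightarrow> (complex \<Rightarrow> complex) set" where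
  "vanishing_subspace \<alpha> l m = {f \<in> fock_infinity \<alpha>. \<forall>k<m. (deriv ^^ k) f l = 0}"

(* The intersection is taken inside the space, which only matters for the empty divisor. *)
definition zero_divisor :: "real \<Rightarrow> (complex \<times> nat) set \<Rightarrow> bool" where
  "zero_divisor \<alpha> X \<longleftrightarrow>
     fock_infinity \<alpha> \<inter> (\<Inter>(l, m)\<in>X. vanishing_subspace \<alpha> l m) \<noteq> {\<lambda>z. 0}"

end

theory Submission
  imports Defs
begin

text \<open>
  Suppose a nonzero \<open>f\<close> vanishes on \<open>X\<close>. Replace the point mass \<open>m\<close> at \<open>\<lambda>\<close> by its balayage, the uniform
  measure of density \<open>\<alpha>/\<pi>\<close> on the disc of radius \<open>\<surd>(m/\<alpha>)\<close> about \<open>\<lambda>\<close>: the factor \<open>|z - \<lambda>|^m\<close> of \<open>|f|\<close>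
  grows inside the disc and is unchanged outside. On the disc the logarithm of the new weighted
  modulus is subharmonic, because the added density cancels that of the weight; by the maximum
  principle on the disc the bound on the weighted modulus of \<open>f\<close> persists, one disc after another.

  Discs of radius at least \<open>\<rho> = 1/\<surd>\<alpha>\<close> that cover a neighbourhood of infinity overlap substantially:
  there are infinitely many disjoint balls of radius \<open>\<rho>/10\<close>, each contained in two of the discs. Put density
  \<open>\<alpha>/\<pi>\<close> on a ball of radius \<open>R0\<close> containing \<open>K\<close>, and sweep the excess density on \<open>L\<close> of the small
  balls to their centres as negative point masses. The result is still log-subharmonic on the ball of
  radius \<open>R\<close>, and on its boundary it is of order \<open>R^(\<alpha> R0\<^sup>2 - L \<alpha> (\<rho>/10)\<^sup>2)\<close>. For large \<open>L\<close> this tends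
  to 0 as \<open>R \<rightarrow> \<infinity>\<close>, while the value at a point where \<open>f \<noteq> 0\<close> stays bounded below.
\<close>

subsection \<open>Functions locally minorised by moduli of holomorphic functions\<close>

text \<open>A substitute for subharmonicity of \<open>ln u\<close> that is multiplicative, allows zeros, and still gives
  the maximum principle, without any integral means.\<close>

definition hol_minorized :: "(complex \<Rightarrow> real) \<Rightarrow> complex \<Rightarrow> bool" where
  "hol_minorized u z \<longleftrightarrow> (\<exists>S G. open S \<and> z \<in> S \<and> G holomorphic_on S \<and>
     (\<forall>w\<in>S. norm (G w) \<le> u w) \<and> norm (G z) = u z)"

lemma hol_minorizedI:
  assumes "open S" "z \<in> S" "G holomorphic_on S" "\<And>w. w \<in> S \<Longrightarrow> norm (G w) \<le> u w" "norm (G z) = u z"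
  shows "hol_minorized u z"
  using assms unfolding hol_minorized_def by blast

text \<open>Touching from below at the single point \<open>z\<close> is enough, which settles points
  on a circle where \<open>u\<close> changes its formula.\<close>

lemma hol_minorized_mono:
  assumes "hol_minorized v z" "open T" "z \<in> T" "\<And>w. w \<in> T \<Longrightarrow> v w \<le> u w" "v z = u z"
  shows "hol_minorized u z"
proof -
  obtain S G where "open S" "z \<in> S" "G holomorphic_on S" 
    "\<forall>w\<in>S. norm (G w) \<le> v w" "norm (G z) = v z"
    using assms(1) unfolding hol_minorized_def by blast
  then show ?thesis
    using assms(2-5) holomorphic_on_subset[of G S "S \<inter> T"]
    by (intro hol_minorizedI[of "S \<inter> T" _ G]) (simp_all add: open_Int, meson order_trans)
qed

lemma hol_minorized_norm: "g holomorphic_on UNIV \<Longrightarrow> hol_minorized (\<lambda>z. norm (g z)) z"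
  by (rule hol_minorizedI[of UNIV]) auto

lemma hol_minorized_const: "0 \<le> c \<Longrightarrow> hol_minorized (\<lambda>_. c) z"
  by (rule hol_minorizedI[of UNIV _ "\<lambda>_. of_real c"]) auto

lemma hol_minorized_mult:
  assumes "hol_minorized u z" "hol_minorized v z"
  shows "hol_minorized (\<lambda>w. u w * v w) z"
proof -
  obtain S G where S: "open S" "z \<in> S" "G holomorphic_on S" 
    "\<forall>w\<in>S. norm (G w) \<le> u w" "norm (G z) = u z"
    using assms(1) unfolding hol_minorized_def by blast
  obtain T H where T: "open T" "z \<in> T" "H holomorphic_on T" 
    "\<forall>w\<in>T. norm (H w) \<le> v w" "norm (H z) = v z"
    using assms(2) unfolding hol_minorized_def by blast
  show ?thesis
  proof (rule hol_minorizedI[of "S \<inter> T" _ "\<lambda>w. G w * H w"])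
    fix w assume w: "w \<in> S \<inter> T"
    have le: "norm (G w) \<le> u w" "norm (H w) \<le> v w" using w S(4) T(4) by auto
    then have "0 \<le> u w" using norm_ge_zero order_trans by blast
    with le show "norm (G w * H w) \<le> u w * v w"
      unfolding norm_mult by (intro mult_mono) auto
  next
    show "(\<lambda>w. G w * H w) holomorphic_on S \<inter> T"
      using holomorphic_on_subset[OF S(3), of "S \<inter> T"] holomorphic_on_subset[OF T(3), of "S \<inter> T"]
      by (intro holomorphic_on_mult) auto
  qed (use S T in \<open>simp_all add: norm_mult open_Int\<close>)
qed

lemma hol_minorized_prod:
  assumes "\<And>i. i \<in> I \<Longrightarrow> hol_minorized (u i) z"
  shows "hol_minorized (\<lambda>w. \<Prod>i\<in>I. u i w) z"
  using assms
  by (induction I rule: infinite_finite_induct) (auto intro: hol_minorized_const hol_minorized_mult)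

text \<open>Otherwise the compact set \<open>T\<close> of maximum points over the closure would lie
  in \<open>U\<close>. It would also be open: near a point of \<open>T\<close> the modulus of the
  holomorphic minorant is largest at that point, so the minorant is constant and keeps
  \<open>u\<close> at its maximum. The plane has no nonempty compact open subset.\<close>

lemma hol_minorized_max_principle:
  fixes u :: "complex \<Rightarrow> real"
  assumes "open U" "bounded U" "continuous_on UNIV u"
    and min: "\<And>z. z \<in> U \<Longrightarrow> hol_minorized u z"
    and bd: "\<And>z. z \<in> frontier U \<Longrightarrow> u z \<le> C"
    and "x \<in> U"
  shows "u x \<le> C"
proof (rule ccontr)
  assume "\<not> u x \<le> C"
  have "compact (closure U)" using assms by simp
  moreover have "closure U \<noteq> {}" using \<open>x \<in> U\<close> closure_subset by auto
  moreover have "continuous_on (closure U) u"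
    using assms(3) continuous_on_subset by blast
  ultimately obtain y where y: "y \<in> closure U" "\<forall>z\<in>closure U. u z \<le> u y"
    using continuous_attains_sup by blast
  have "x \<in> closure U" using \<open>x \<in> U\<close> closure_subset by auto
  then have "C < u y" using y \<open>\<not> u x \<le> C\<close> by force
  define T where "T = {z \<in> closure U. u z = u y}"
  have "T = closure U \<inter> (u -` {u y})" by (auto simp: T_def)
  moreover have "closed (u -` {u y})"
    using assms(3) closed_vimage closed_singleton by metis
  ultimately have "compact T"
    using \<open>compact (closure U)\<close> compact_Int_closed by blast
  have TU: "T \<subseteq> U"
  proof
    fix z assume "z \<in> T"
    then have "z \<in> closure U" "u z = u y" by (auto simp: T_def)
    then have "z \<notin> frontier U" using bd[of z] \<open>C < u y\<close> by linarith
    then show "z \<in> U"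
      using \<open>z \<in> closure U\<close> \<open>open U\<close> by (simp add: frontier_def interior_open)
  qed
  have "open T"
  proof (subst openI)
    fix z assume "z \<in> T"
    then have "z \<in> U" "u z = u y" using TU by (auto simp: T_def)
    obtain S G where S: "open S" "z \<in> S" "G holomorphic_on S" 
      "\<forall>w\<in>S. norm (G w) \<le> u w" "norm (G z) = u z"
      using min[OF \<open>z \<in> U\<close>] unfolding hol_minorized_def by blast
    obtain e where e: "e > 0" "ball z e \<subseteq> S \<inter> U"
      using S(1,2) \<open>z \<in> U\<close> \<open>open U\<close> by (meson IntI open_Int open_contains_ball)
    have le: "norm (G w) \<le> norm (G z)" "u w \<le> u y" if "w \<in> ball z e" for w
    proof -
      have "w \<in> closure U" using e that closure_subset by blast
      then show "u w \<le> u y" using y by blast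
      moreover have "norm (G w) \<le> u w" using S(4) e(2) that by blast
      ultimately show "norm (G w) \<le> norm (G z)" using S(5) \<open>u z = u y\<close> by linarith
    qed
    have "G holomorphic_on ball z e" using S(3) e holomorphic_on_subset by blast
    then have "G constant_on ball z e"
      using e le(1) by (intro maximum_modulus_principle[of G "ball z e" "ball z e" z]) simp_all
    then have const: "G w = G z" if "w \<in> ball z e" for w
      using that e(1) by (metis centre_in_ball constant_on_def)
    have "ball z e \<subseteq> T"
    proof
      fix w assume w: "w \<in> ball z e"
      then have "w \<in> S" "w \<in> closure U" using e(2) closure_subset by blast+
      moreover have "u y \<le> u w"
        using const[OF w] S(4,5) \<open>w \<in> S\<close> \<open>u z = u y\<close> by metis
      ultimately show "w \<in> T" using le(2)[OF w] by (simp add: T_def)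
    qed
    then show "\<exists>e>0. ball z e \<subseteq> T" using e by blast
  qed simp
  have "T = {} \<or> T = UNIV"
    using \<open>open T\<close> \<open>compact T\<close> clopen compact_imp_closed by blast
  moreover have "y \<in> T" using y by (simp add: T_def)
  moreover have "T \<noteq> UNIV" using \<open>compact T\<close> compact_imp_bounded not_bounded_UNIV by metis
  ultimately show False by auto
qed

section \<open>Potentials of uniform measures on discs\<close>

text \<open>\<open>swept \<alpha> c r\<close> is the exponential of the logarithmic potential of the uniform measure of density
  \<open>\<alpha>/\<pi>\<close> on the disc of radius \<open>r\<close> about \<open>c\<close>; the total mass is \<open>\<alpha> r\<^sup>2\<close>.\<close>

definition swept_const :: "real \<Rightarrow> real \<Rightarrow> real" where
  "swept_const \<alpha> r = r powr (\<alpha> * r\<^sup>2) * exp (- (\<alpha> / 2 * r\<^sup>2))"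

definition swept :: "real \<Rightarrow> complex \<Rightarrow> real \<Rightarrow> complex \<Rightarrow> real" where
  "swept \<alpha> c r z = (if norm (z - c) \<le> r
     then swept_const \<alpha> r * exp (\<alpha> / 2 * (norm (z - c))\<^sup>2)
     else norm (z - c) powr (\<alpha> * r\<^sup>2))"

text \<open>This is ln x \<le> x - 1 at x = t^2 / r^2, multiplied by \<alpha> r^2 / 2. With the
  factor \<open>swept_const\<close> the Gaussian touches the power from above at t = r.\<close>

lemma powr_le_gaussian:
  fixes \<alpha> r t :: real
  assumes "0 < \<alpha>" "0 < r" "0 \<le> t"
  shows "t powr (\<alpha> * r\<^sup>2) \<le> swept_const \<alpha> r * exp (\<alpha> / 2 * t\<^sup>2)"
proof (cases "t = 0")
  case False
  then have "t > 0" using assms by simp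
  have "ln (t\<^sup>2 / r\<^sup>2) \<le> t\<^sup>2 / r\<^sup>2 - 1"
    using \<open>t > 0\<close> assms by (intro ln_le_minus_one) simp
  moreover have "ln (t\<^sup>2 / r\<^sup>2) = 2 * ln t - 2 * ln r"
    using \<open>t > 0\<close> assms by (simp add: ln_div ln_realpow)
  ultimately have "(\<alpha> * r\<^sup>2 / 2) * (2 * ln t - 2 * ln r) \<le> (\<alpha> * r\<^sup>2 / 2) * (t\<^sup>2 / r\<^sup>2 - 1)"
    using assms by (intro mult_left_mono) auto
  moreover have "(\<alpha> * r\<^sup>2 / 2) * (t\<^sup>2 / r\<^sup>2 - 1) = \<alpha> / 2 * (t\<^sup>2 - r\<^sup>2)"
    using assms by (simp add: field_simps)
  ultimately have "\<alpha> * r\<^sup>2 * ln t \<le> \<alpha> * r\<^sup>2 * ln r + \<alpha> / 2 * (t\<^sup>2 - r\<^sup>2)"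
    by (simp add: algebra_simps)
  then show ?thesis
    using \<open>t > 0\<close> assms by (simp add: powr_def swept_const_def right_diff_distrib flip: exp_add)
qed (simp add: swept_const_def)

lemma gaussian_boundary: "0 < r \<Longrightarrow> swept_const \<alpha> r * exp (\<alpha> * r\<^sup>2 / 2) = r powr (\<alpha> * r\<^sup>2)"
  by (simp add: swept_const_def exp_minus)

lemma swept_const_pos: "0 < r \<Longrightarrow> 0 < swept_const \<alpha> r"
  by (simp add: swept_const_def)

lemma swept_pos: "0 < r \<Longrightarrow> 0 < swept \<alpha> c r z"
  by (auto simp: swept_def swept_const_pos)

lemma swept_inside:
  "norm (z - c) \<le> r \<Longrightarrow> swept \<alpha> c r z = swept_const \<alpha> r * exp (\<alpha> / 2 * (norm (z - c))\<^sup>2)"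
  by (simp add: swept_def)

lemma swept_outside: "0 < r \<Longrightarrow> r \<le> norm (z - c) \<Longrightarrow> swept \<alpha> c r z = norm (z - c) powr (\<alpha> * r\<^sup>2)"
  using gaussian_boundary[of r \<alpha>] by (auto simp: swept_def antisym_conv)

lemma powr_le_swept:
  "0 < \<alpha> \<Longrightarrow> 0 < r \<Longrightarrow> norm (z - c) powr (\<alpha> * r\<^sup>2) \<le> swept \<alpha> c r z"
  using powr_le_gaussian[of \<alpha> r "norm (z - c)"] by (auto simp: swept_def)

lemma swept_le_gaussian:
  "0 < \<alpha> \<Longrightarrow> 0 < r \<Longrightarrow>
    swept \<alpha> c r z \<le> swept_const \<alpha> r * exp (\<alpha> / 2 * (norm (z - c))\<^sup>2)"
  using powr_le_gaussian[of \<alpha> r "norm (z - c)"] by (auto simp: swept_def)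

lemma continuous_on_swept:
  assumes "0 < r"
  shows "continuous_on UNIV (swept \<alpha> c r)"
proof -
  have "continuous_on ({z. norm (z - c) \<le> r} \<union> {z. r \<le> norm (z - c)}) (swept \<alpha> c r)"
    unfolding swept_def using assms
    by (intro continuous_on_cases)
      (auto intro!: continuous_intros closed_Collect_le simp: gaussian_boundary antisym_conv)
  moreover have "{z. norm (z - c) \<le> r} \<union> {z. r \<le> norm (z - c)} = UNIV" by auto
  ultimately show ?thesis by simp
qed

text \<open>On the half-plane \<open>S\<close> the principal logarithm of (w - c) / (z - c) is
  holomorphic. Up to a unimodular constant, \<open>G\<close> is a branch of (w - c)^a, so its
  modulus equals the given function there.\<close>

lemma hol_minorized_norm_powr:
  assumes "z \<noteq> c"
  shows "hol_minorized (\<lambda>w. norm (w - c) powr a) z"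
proof -
  define G where "G = (\<lambda>w. of_real (norm (z - c) powr a) * exp (of_real a * Ln ((w - c) / (z - c))))"
  define S where "S = {w. 0 < Re ((w - c) / (z - c))}"
  have "open S" unfolding S_def using assms
    by (intro open_Collect_less continuous_intros) auto
  have S: "(w - c) / (z - c) \<notin> \<real>\<^sub>\<le>\<^sub>0" "w \<noteq> c" if "w \<in> S" for w
    using that unfolding S_def by (auto simp: complex_nonpos_Reals_iff)
  have eq: "norm (G w) = norm (w - c) powr a" if "w \<in> S" for w
    using assms S[OF that]
    by (simp add: G_def norm_mult norm_divide powr_def ln_div algebra_simps flip: exp_add)
  have "G holomorphic_on S"
    unfolding G_def using S assms by (auto intro!: holomorphic_intros)
  moreover have "z \<in> S" using assms by (simp add: S_def)
  ultimately show ?thesis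
    using \<open>open S\<close> eq by (intro hol_minorizedI[of S _ G]) auto
qed

text \<open>The quadratic terms cancel: the difference of squares is |a|^2 - |b|^2 + 2 Re (cnj (b -
  a) w), so the function is the modulus of the entire function \<open>G\<close>.\<close>

lemma hol_minorized_gaussian_quotient:
  "hol_minorized (\<lambda>w. exp (\<alpha> / 2 * ((norm (w - a))\<^sup>2 - (norm (w - b))\<^sup>2))) z"
proof -
  define G where "G = (\<lambda>w. exp (of_real (\<alpha> / 2 * ((norm a)\<^sup>2 - (norm b)\<^sup>2)) + of_real \<alpha> * cnj (b - a) * w))"
  have "norm (G w) = exp (\<alpha> / 2 * ((norm (w - a))\<^sup>2 - (norm (w - b))\<^sup>2))" for w
    unfolding G_def norm_exp_eq_Re cmod_power2 by (simp add: power2_eq_square algebra_simps)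
  then show ?thesis
    by (intro hol_minorizedI[of UNIV _ G]) (auto simp: G_def intro!: holomorphic_intros)
qed

text \<open>Take \<open>z\<close> itself as second centre of the quotient: the additional factor is
  at most 1, with equality at \<open>z\<close>.\<close>

lemma hol_minorized_gaussian:
  assumes "0 < \<alpha>"
  shows "hol_minorized (\<lambda>w. exp (\<alpha> / 2 * (norm (w - c))\<^sup>2)) z"
  using hol_minorized_gaussian_quotient[of \<alpha> c z z]
  by (rule hol_minorized_mono[of _ _ UNIV]) (use assms in auto)

text \<open>Inside the open disc \<open>swept\<close> is a multiple of a Gaussian. Elsewhere, the
  circle included, the power of |w - c| lies below \<open>swept\<close> in the whole plane and
  agrees with it at \<open>z\<close>.\<close>

lemma hol_minorized_swept:
  assumes "0 < \<alpha>" "0 < r"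
  shows "hol_minorized (swept \<alpha> c r) z"
proof (cases "norm (z - c) < r")
  case True
  have "hol_minorized (\<lambda>w. swept_const \<alpha> r * exp (\<alpha> / 2 * (norm (w - c))\<^sup>2)) z"
    using assms by (intro hol_minorized_mult hol_minorized_gaussian hol_minorized_const) (auto simp: swept_const_def)
  then show ?thesis
    by (rule hol_minorized_mono[of _ _ "ball c r"])
      (use True in \<open>auto simp: swept_inside dist_norm norm_minus_commute\<close>)
next
  case False
  then have "z \<noteq> c" using assms by auto
  have "swept \<alpha> c r z = norm (z - c) powr (\<alpha> * r\<^sup>2)"
    using False assms by (intro swept_outside) auto
  then show ?thesis
    by (intro hol_minorized_mono[OF hol_minorized_norm_powr[OF \<open>z \<noteq> c\<close>] open_UNIV UNIV_I])
      (simp_all add: powr_le_swept[OF assms])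
qed

text \<open>The densities cancel: on the disc the product is a constant times a quotient of two
  Gaussians, with centres \<open>c\<close> and 0.\<close>

lemma hol_minorized_swept_gaussian:
  assumes "z \<in> ball c r"
  shows "hol_minorized (\<lambda>w. swept \<alpha> c r w * exp (- (\<alpha> / 2) * (norm w)\<^sup>2)) z"
proof -
  have "hol_minorized (\<lambda>w. swept_const \<alpha> r
      * exp (\<alpha> / 2 * ((norm (w - c))\<^sup>2 - (norm (w - 0))\<^sup>2))) z"
    by (intro hol_minorized_mult hol_minorized_gaussian_quotient hol_minorized_const) (auto simp: swept_const_def)
  moreover have "swept_const \<alpha> r * exp (\<alpha> / 2 * ((norm (w - c))\<^sup>2 - (norm (w - 0))\<^sup>2)) =
      swept \<alpha> c r w * exp (- (\<alpha> / 2) * (norm w)\<^sup>2)" if "w \<in> ball c r" for w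
    unfolding right_diff_distrib exp_diff
    using that by (simp add: swept_inside dist_norm norm_minus_commute exp_minus inverse_eq_divide)
  ultimately show ?thesis
    using assms by (elim hol_minorized_mono[of _ _ "ball c r"]) auto
qed

lemma hol_minorized_inverse_swept:
  assumes "0 < r" "z \<notin> cball c r"
  shows "hol_minorized (\<lambda>w. inverse (swept \<alpha> c r w)) z"
proof -
  have "z \<noteq> c" using assms by auto
  then have "hol_minorized (\<lambda>w. norm (w - c) powr - (\<alpha> * r\<^sup>2)) z" 
    by (rule hol_minorized_norm_powr)
  moreover have "norm (w - c) powr - (\<alpha> * r\<^sup>2) = inverse (swept \<alpha> c r w)" if "w \<in> - cball c r" for w
  proof -
    have "r \<le> norm (w - c)" using that by (simp add: dist_norm norm_minus_commute)
    then show ?thesis using assms by (simp add: swept_outside powr_minus)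
  qed
  ultimately show ?thesis
    using assms by (elim hol_minorized_mono[of _ _ "- cball c r"]) auto
qed

text \<open>The density of the disc about \<open>c\<close> compensates the negative density on the
  disc about \<open>q\<close>. As \<open>swept\<close> lies below its Gaussian everywhere, a
  quotient of Gaussians is a minorant near \<open>z\<close>, and it is sharp on the closed disc
  about \<open>q\<close>.\<close>

lemma hol_minorized_swept_quotient:
  assumes "0 < \<alpha>" "0 < s" "z \<in> cball q s" "z \<in> ball c r"
  shows "hol_minorized (\<lambda>w. swept \<alpha> c r w * inverse (swept \<alpha> q s w)) z"
proof -
  define k where "k = swept_const \<alpha> r * inverse (swept_const \<alpha> s)"
  have k: "k * exp (\<alpha> / 2 * ((norm (w - c))\<^sup>2 - (norm (w - q))\<^sup>2)) =
      swept \<alpha> c r w * inverse (swept_const \<alpha> s * exp (\<alpha> / 2 * (norm (w - q))\<^sup>2))"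
    if "w \<in> ball c r" for w
    unfolding right_diff_distrib exp_diff
    using that by (simp add: k_def swept_inside dist_norm norm_minus_commute inverse_eq_divide)
  have "hol_minorized (\<lambda>w. k * exp (\<alpha> / 2 * ((norm (w - c))\<^sup>2 - (norm (w - q))\<^sup>2))) z"
    by (intro hol_minorized_mult hol_minorized_gaussian_quotient hol_minorized_const) (simp add: k_def swept_const_def)
  then show ?thesis
  proof (rule hol_minorized_mono[of _ _ "ball c r"])
    fix w assume w: "w \<in> ball c r"
    have "0 < r" using w by (metis ball_eq_empty empty_iff not_le)
    show "k * exp (\<alpha> / 2 * ((norm (w - c))\<^sup>2 - (norm (w - q))\<^sup>2)) \<le> swept \<alpha> c r w * inverse (swept \<alpha> q s w)"
      unfolding k[OF w] using assms swept_le_gaussian[of \<alpha> s q w] swept_pos[OF \<open>0 < s\<close>] swept_pos[OF \<open>0 < r\<close>]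
      by (intro mult_left_mono le_imp_inverse_le) (auto intro: less_imp_le simp: swept_const_pos)
  next
    show "k * exp (\<alpha> / 2 * ((norm (z - c))\<^sup>2 - (norm (z - q))\<^sup>2)) = swept \<alpha> c r z * inverse (swept \<alpha> q s z)"
      unfolding k[OF assms(4)] using assms(3) by (simp add: swept_inside dist_norm norm_minus_commute)
  qed (use assms in auto)
qed

subsection \<open>Division of entire functions by linear factors\<close>

lemma entire_factor_root:
  assumes "f holomorphic_on UNIV" "f a = 0"
  obtains g where "g holomorphic_on UNIV" "\<And>z. f z = (z - a) * g z"
proof
  show "(\<lambda>z. if z = a then deriv f a else (f z - f a) / (z - a)) holomorphic_on UNIV"
    using assms by (intro pole_lemma_open) auto
  show "f z = (z - a) * (if z = a then deriv f a else (f z - f a) / (z - a))" for z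
    using assms by simp
qed

lemma entire_cancel_linear:
  fixes f g :: "complex \<Rightarrow> complex"
  assumes "f holomorphic_on UNIV" "g holomorphic_on UNIV" "\<And>z. (z - a) * f z = (z - a) * g z"
  shows "f z = g z"
proof (cases "z = a")
  case True
  have "isCont f a" "isCont g a"
    using assms(1,2) holomorphic_on_imp_continuous_on continuous_on_eq_continuous_at[OF open_UNIV]
    by blast+
  moreover have "eventually (\<lambda>z. f z = g z) (at a)"
    using assms(3) by (auto simp: eventually_at intro!: exI[of _ 1])
  ultimately have "f \<midarrow>a\<rightarrow> f a" "f \<midarrow>a\<rightarrow> g a"
    by (auto simp: isCont_def tendsto_cong)
  then show ?thesis using True LIM_unique by blast
qed (use assms(3)[of z] in simp)

text \<open>Transfers the order of a zero of the product to the factor \<open>g\<close>. For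
  positive \<open>m\<close>, \<open>g\<close> must vanish at \<open>a\<close> because
  \<open>p\<close> does not; a linear factor is cancelled and induction continues.\<close>

lemma entire_factor_coprime:
  assumes "g holomorphic_on UNIV" "p holomorphic_on UNIV" "h holomorphic_on UNIV" "p a \<noteq> 0"
    and "\<And>z. g z * p z = (z - a) ^ m * h z"
  obtains k where "k holomorphic_on UNIV" "\<And>z. g z = (z - a) ^ m * k z"
proof -
  have "\<exists>k. k holomorphic_on UNIV \<and> (\<forall>z. g z = (z - a) ^ m * k z)"
    using assms(1,5)
  proof (induction m arbitrary: g)
    case (Suc m)
    have "g a = 0" using Suc.prems(2)[of a] \<open>p a \<noteq> 0\<close> by simp
    then obtain g1 where g1: "g1 holomorphic_on UNIV" "\<And>z. g z = (z - a) * g1 z"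
      using entire_factor_root Suc.prems(1) by blast
    have "g1 z * p z = (z - a) ^ m * h z" for z
    proof (rule entire_cancel_linear[of "\<lambda>z. g1 z * p z" "\<lambda>z. (z - a) ^ m * h z" a])
      show "(\<lambda>z. g1 z * p z) holomorphic_on UNIV" "(\<lambda>z. (z - a) ^ m * h z) holomorphic_on UNIV"
        using g1 assms by (auto intro!: holomorphic_intros)
      show "(z - a) * (g1 z * p z) = (z - a) * ((z - a) ^ m * h z)" for z
        using Suc.prems(2)[of z] g1(2)[of z] by (simp add: mult.assoc)
    qed
    then obtain k where "k holomorphic_on UNIV" "\<forall>z. g1 z = (z - a) ^ m * k z"
      using Suc.IH g1(1) by blast
    then show ?case using g1(2) by (auto simp: mult.assoc)
  qed auto
  then show ?thesis using that by blast
qed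

lemma higher_deriv_linear_mult:
  assumes "g holomorphic_on UNIV"
  shows "(deriv ^^ Suc n) (\<lambda>z. (z - a) * g z) =
    (\<lambda>z. (z - a) * (deriv ^^ Suc n) g z + of_nat (Suc n) * (deriv ^^ n) g z)"
proof -
  have D: "((deriv ^^ n) g has_field_derivative (deriv ^^ Suc n) g z) (at z)" for n z
    using has_field_derivative_higher_deriv[OF assms open_UNIV] by simp
  show ?thesis
  proof (induction n)
    case 0
    have "((\<lambda>z. (z - a) * g z) has_field_derivative (z - a) * deriv g z + g z) (at z)" for z
      using D[of 0 z] by (auto intro!: derivative_eq_intros)
    then show ?case by (auto dest!: DERIV_imp_deriv)
  next
    case (Suc n)
    have "((\<lambda>z. (z - a) * (deriv ^^ Suc n) g z + of_nat (Suc n) * (deriv ^^ n) g z) has_field_derivative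
        (z - a) * (deriv ^^ Suc (Suc n)) g z + of_nat (Suc (Suc n)) * (deriv ^^ Suc n) g z) (at z)" for z
      by (rule derivative_eq_intros D refl)+ (simp add: algebra_simps del: funpow.simps)
    then have "deriv (\<lambda>z. (z - a) * (deriv ^^ Suc n) g z + of_nat (Suc n) * (deriv ^^ n) g z) =
        (\<lambda>z. (z - a) * (deriv ^^ Suc (Suc n)) g z + of_nat (Suc (Suc n)) * (deriv ^^ Suc n) g z)"
      using DERIV_imp_deriv by blast
    then show ?case
      unfolding Suc[symmetric] by simp
  qed
qed

text \<open>At \<open>a\<close> the Leibniz formula leaves only k + 1 times the k-th derivative of
  the cofactor, so the cofactor vanishes to one order less and induction applies.\<close>

lemma entire_factor_order:
  assumes "f holomorphic_on UNIV" "\<And>k. k < m \<Longrightarrow> (deriv ^^ k) f a = 0"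
  shows "\<exists>h. h holomorphic_on UNIV \<and> (\<forall>z. f z = (z - a) ^ m * h z)"
  using assms
proof (induction m arbitrary: f)
  case (Suc m)
  have "f a = 0" using Suc.prems(2)[of 0] by simp
  then obtain g where g: "g holomorphic_on UNIV" "\<And>z. f z = (z - a) * g z"
    using entire_factor_root Suc.prems(1) by blast
  have "(deriv ^^ k) g a = 0" if "k < m" for k
  proof -
    have f: "f = (\<lambda>z. (z - a) * g z)" using g(2) by auto
    have "(deriv ^^ Suc k) f a = of_nat (Suc k) * (deriv ^^ k) g a"
      unfolding f higher_deriv_linear_mult[OF g(1)] by simp
    then show ?thesis using Suc.prems(2)[of "Suc k"] that
      by (metis Suc_mono mult_eq_0_iff of_nat_eq_0_iff nat.distinct(2))
  qed
  then obtain h where "h holomorphic_on UNIV" "\<forall>z. g z = (z - a) ^ m * h z"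
    using Suc.IH g(1) by blast
  then show ?case using g(2) by (auto simp: mult.assoc)
qed auto

subsection \<open>Sweeping out the zeros\<close>

lemma norm_power_le_swept:
  assumes "0 < \<alpha>" "0 < r" "\<alpha> * r\<^sup>2 = real m"
  shows "norm (z - c) ^ m \<le> swept \<alpha> c r z"
proof (cases "z = c")
  case True
  \<comment> \<open>Positive mass excludes m = 0, for which the power at the centre would be
    1.\<close>
  have "0 < \<alpha> * r\<^sup>2" using assms(1,2) by simp
  then have "m \<noteq> 0" using assms(3) by simp
  then show ?thesis using True swept_pos[OF assms(2), of \<alpha> c z] by (simp add: power_0_left)
next
  case False
  then show ?thesis
    using powr_le_swept[OF assms(1,2), of z c] assms(3) by (simp add: powr_realpow)
qed

lemma swept_eq_norm_power:
  assumes "0 < r" "\<alpha> * r\<^sup>2 = real m" "r \<le> norm (z - c)"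
  shows "swept \<alpha> c r z = norm (z - c) ^ m"
proof -
  have "0 < norm (z - c)" using assms by linarith
  then show ?thesis using swept_outside[OF assms(1,3)] assms(2) by (simp add: powr_realpow)
qed

text \<open>Induction over the discs, turning one more factor |z - c|^m into \<open>swept\<close>
  while keeping the bound \<open>C\<close>. Nothing changes outside the new disc; inside, its
  density cancels the weight and the maximum principle carries the bound in from the circle.\<close>

lemma swept_bound:
  fixes c :: "'i \<Rightarrow> complex" and m :: "'i \<Rightarrow> nat"
  assumes "0 < \<alpha>" "finite F" "inj_on c F"
    and r: "\<And>i. i \<in> F \<Longrightarrow> 0 < r i" "\<And>i. i \<in> F \<Longrightarrow> \<alpha> * (r i)\<^sup>2 = real (m i)"
    and "f holomorphic_on UNIV"
    and zeros: "\<And>i. i \<in> F \<Longrightarrow> \<exists>h. h holomorphic_on UNIV \<and> (\<forall>z. f z = (z - c i) ^ m i * h z)"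
    and bound: "\<And>z. norm (f z) * exp (- (\<alpha> / 2) * (norm z)\<^sup>2) \<le> C"
  shows "\<exists>g. g holomorphic_on UNIV \<and> (\<forall>z. f z = g z * (\<Prod>i\<in>F. (z - c i) ^ m i)) \<and>
    (\<forall>z. norm (g z) * (\<Prod>i\<in>F. swept \<alpha> (c i) (r i) z) * exp (- (\<alpha> / 2) * (norm z)\<^sup>2) \<le> C)"
  using assms(2,3) r zeros
proof (induction F)
  case empty
  show ?case using \<open>f holomorphic_on UNIV\<close> bound by (intro exI[of _ f]) simp
next
  case (insert n F)
  have "inj_on c F" using insert.prems(1) by simp
  then obtain g where g: "g holomorphic_on UNIV"
      "\<And>z. f z = g z * (\<Prod>i\<in>F. (z - c i) ^ m i)"
    and gC: "\<And>z. norm (g z) * (\<Prod>i\<in>F. swept \<alpha> (c i) (r i) z) * exp (- (\<alpha> / 2) * (norm z)\<^sup>2) \<le> C"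
    using insert.IH[OF _ insert.prems(2)[OF insertI2] insert.prems(3)[OF insertI2]
        insert.prems(4)[OF insertI2]] by blast
  obtain h where h: "h holomorphic_on UNIV" "\<And>z. f z = (z - c n) ^ m n * h z"
    using insert.prems(4) by blast
  have rn: "0 < r n" "\<alpha> * (r n)\<^sup>2 = real (m n)" and rF: "\<And>i. i \<in> F \<Longrightarrow> 0 < r i"
    using insert.prems by auto
  have "(\<lambda>z. \<Prod>i\<in>F. (z - c i) ^ m i) holomorphic_on UNIV" by (intro holomorphic_intros)
  \<comment> \<open>The points are distinct, so the factors already split off do not vanish at
    \<open>c n\<close> and \<open>g\<close> keeps the full order there.\<close>
  moreover have "(\<Prod>i\<in>F. (c n - c i) ^ m i) \<noteq> 0"
    using insert by (auto simp: inj_on_insert)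
  moreover have "g z * (\<Prod>i\<in>F. (z - c i) ^ m i) = (z - c n) ^ m n * h z" for z
    using g(2)[of z] h(2)[of z] by simp
  ultimately obtain k where k: "k holomorphic_on UNIV" "\<And>z. g z = (z - c n) ^ m n * k z"
    using entire_factor_coprime[OF g(1) _ h(1), of "\<lambda>z. \<Prod>i\<in>F. (z - c i) ^ m i" "c n" "m n"] by blast
  define u where "u = (\<lambda>z. norm (k z) * (\<Prod>i\<in>insert n F. swept \<alpha> (c i) (r i) z) * exp (- (\<alpha> / 2) * (norm z)\<^sup>2))"
  have u_eq: "u z = norm (k z) * (\<Prod>i\<in>F. swept \<alpha> (c i) (r i) z) *
      (swept \<alpha> (c n) (r n) z * exp (- (\<alpha> / 2) * (norm z)\<^sup>2))" for z
    using insert.hyps by (simp add: u_def)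
  have outside: "u z \<le> C" if "r n \<le> norm (z - c n)" for z
    using gC[of z] swept_eq_norm_power[OF rn that]
    by (simp add: u_eq k(2) norm_mult norm_power mult_ac)
  have "u z \<le> C" for z
  proof (cases "r n \<le> norm (z - c n)")
    case False
    show ?thesis
    proof (rule hol_minorized_max_principle)
      show "continuous_on UNIV u"
        unfolding u_def using insert.prems(2) k(1) 
        by (intro continuous_intros continuous_on_swept) (auto intro: holomorphic_on_imp_continuous_on)
      show "hol_minorized u w" if "w \<in> ball (c n) (r n)" for w
        unfolding u_eq using that k(1) rF \<open>0 < \<alpha>\<close>
        by (intro hol_minorized_mult hol_minorized_norm hol_minorized_prod hol_minorized_swept
            hol_minorized_swept_gaussian)
      show "u w \<le> C" if "w \<in> frontier (ball (c n) (r n))" for w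
        using that rn(1) by (intro outside) (simp add: dist_norm norm_minus_commute)
      show "z \<in> ball (c n) (r n)" using False by (simp add: dist_norm norm_minus_commute)
    qed auto
  qed (rule outside)
  moreover have "f z = k z * (\<Prod>i\<in>insert n F. (z - c i) ^ m i)" for z
    using insert.hyps by (simp add: g(2) k(2) mult_ac)
  ultimately show ?case using k(1) by (auto simp: u_def)
qed

subsection \<open>Overlaps in coverings by large discs\<close>

text \<open>The three squared distances and |x + y + z|^2 add up to 3 (|x|^2 + |y|^2 + |z|^2), so
  the squared distances average at most 3 \<rho>^2.\<close>

lemma three_points_in_disc:
  fixes x y z :: complex
  assumes "norm x \<le> \<rho>" "norm y \<le> \<rho>" "norm z \<le> \<rho>"
  shows "(norm (x - y))\<^sup>2 \<le> 3 * \<rho>\<^sup>2 \<or> (norm (y - z))\<^sup>2 \<le> 3 * \<rho>\<^sup>2 \<or> (norm (x - z))\<^sup>2 \<le> 3 * \<rho>\<^sup>2"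
proof -
  have "(norm (x - y))\<^sup>2 + (norm (y - z))\<^sup>2 + (norm (x - z))\<^sup>2 + (norm (x + y + z))\<^sup>2
      = 3 * ((norm x)\<^sup>2 + (norm y)\<^sup>2 + (norm z)\<^sup>2)"
    unfolding cmod_power2 by (simp add: power2_eq_square algebra_simps)
  moreover have "(norm x)\<^sup>2 \<le> \<rho>\<^sup>2" "(norm y)\<^sup>2 \<le> \<rho>\<^sup>2" "(norm z)\<^sup>2 \<le> \<rho>\<^sup>2"
    using assms by (simp_all add: power_mono)
  ultimately have "(norm (x - y))\<^sup>2 + (norm (y - z))\<^sup>2 + (norm (x - z))\<^sup>2 \<le> 9 * \<rho>\<^sup>2"
    using zero_le_power2[of "norm (x + y + z)"] by (smt (verit))
  then show ?thesis by argo
qed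

text \<open>The homothety with centre \<open>z\<close> and ratio \<rho> / r maps the disc into
  itself; \<open>d\<close> is the image of \<open>c\<close>.\<close>

lemma inner_ball:
  fixes z c :: complex
  assumes "0 < \<rho>" "\<rho> \<le> r" "z \<in> ball c r"
  obtains d where "norm (d - z) < \<rho>" "ball d \<rho> \<subseteq> ball c r"
proof
  define d where "d = c + of_real (1 - \<rho> / r) * (z - c)"
  have r: "norm (z - c) < r" "0 < r" using assms by (auto simp: dist_norm norm_minus_commute)
  have "d - z = of_real (- (\<rho> / r)) * (z - c)" by (simp add: d_def algebra_simps)
  then have "norm (d - z) = \<rho> / r * norm (z - c)" using assms r by (simp add: norm_mult norm_divide)
  also have "\<dots> < \<rho> / r * r" using r assms by (intro mult_strict_left_mono) auto
  finally show "norm (d - z) < \<rho>" using r by simp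
  have "norm (d - c) = (1 - \<rho> / r) * norm (z - c)"
    using assms r by (simp add: d_def norm_mult del: of_real_diff of_real_divide)
  also have "\<dots> \<le> (1 - \<rho> / r) * r" using r assms by (intro mult_left_mono) auto
  finally have "norm (d - c) \<le> r - \<rho>" using r by (simp add: algebra_simps)
  then show "ball d \<rho> \<subseteq> ball c r"
    by (simp add: ball_subset_ball_iff dist_norm)
qed

lemma ball_overlap_midpoint:
  fixes c d z :: complex
  assumes "0 < \<rho>" "norm (c - z) < \<rho>" "norm (d - z) < \<rho>" "(norm (c - d))\<^sup>2 \<le> 3 * \<rho>\<^sup>2"
  shows "\<exists>q. norm (q - z) < \<rho> \<and> cball q (\<rho> / 10) \<subseteq> ball c \<rho> \<inter> ball d \<rho>"
proof (intro exI conjI)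
  define q where "q = midpoint c d"
  have "0 < \<rho>\<^sup>2" using assms by simp
  \<comment> \<open>9/5 exceeds the square root of 3, and its half leaves the margin \<rho> / 10
    about the midpoint.\<close>
  moreover have "(9 / 5 * \<rho>)\<^sup>2 = 81 / 25 * \<rho>\<^sup>2" by (simp add: power2_eq_square)
  ultimately have "(norm (c - d))\<^sup>2 < (9 / 5 * \<rho>)\<^sup>2" using assms(4) by linarith
  then have "norm (c - d) < 9 / 5 * \<rho>" using assms(1) by (intro power_less_imp_less_base[of _ 2 "9 / 5 * \<rho>"]) simp_all
  then have "dist q c < 9 / 10 * \<rho>" "dist q d < 9 / 10 * \<rho>"
    unfolding q_def dist_midpoint by (simp_all add: dist_norm)
  then show "cball q (\<rho> / 10) \<subseteq> ball c \<rho> \<inter> ball d \<rho>"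
    by (simp add: cball_subset_ball_iff)
  have "c \<in> ball z \<rho>" "d \<in> ball z \<rho>"
    using assms by (auto simp: dist_norm norm_minus_commute)
  then have "q \<in> ball z \<rho>"
    unfolding q_def by (metis closed_segment_subset convex_ball midpoint_in_closed_segment subsetD)
  then show "norm (q - z) < \<rho>" by (simp add: dist_norm norm_minus_commute)
qed

text \<open>Each disc contains a disc of radius \<rho> that still contains \<open>z\<close>. The
  three new centres lie within \<rho> of \<open>z\<close>, so two of them are close enough for their
  midpoint to serve as \<open>q\<close>.\<close>

lemma triple_point_overlap:
  fixes z :: complex
  assumes "0 < \<rho>" "\<rho> \<le> r i" "\<rho> \<le> r j" "\<rho> \<le> r k"
    "z \<in> ball (c i) (r i)" "z \<in> ball (c j) (r j)" "z \<in> ball (c k) (r k)"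
    "i \<noteq> j" "i \<noteq> k" "j \<noteq> k"
  shows "\<exists>a\<in>{i, j, k}. \<exists>b\<in>{i, j, k}. a \<noteq> b \<and>
    (\<exists>q. norm (q - z) < \<rho> \<and> cball q (\<rho> / 10) \<subseteq> ball (c a) (r a) \<inter> ball (c b) (r b))"
proof -
  obtain x where x: "norm (x - z) < \<rho>" "ball x \<rho> \<subseteq> ball (c i) (r i)"
    by (rule inner_ball[OF assms(1) assms(2) assms(5)])
  obtain y where y: "norm (y - z) < \<rho>" "ball y \<rho> \<subseteq> ball (c j) (r j)"
    by (rule inner_ball[OF assms(1) assms(3) assms(6)])
  obtain w where w: "norm (w - z) < \<rho>" "ball w \<rho> \<subseteq> ball (c k) (r k)"
    by (rule inner_ball[OF assms(1) assms(4) assms(7)])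
  have "(norm (x - y))\<^sup>2 \<le> 3 * \<rho>\<^sup>2 \<or> (norm (y - w))\<^sup>2 \<le> 3 * \<rho>\<^sup>2 \<or> (norm (x - w))\<^sup>2 \<le> 3 * \<rho>\<^sup>2"
    using three_points_in_disc[of "x - z" \<rho> "y - z" "w - z"] x y w by simp
  then consider "(norm (x - y))\<^sup>2 \<le> 3 * \<rho>\<^sup>2" | "(norm (y - w))\<^sup>2 \<le> 3 * \<rho>\<^sup>2" | "(norm (x - w))\<^sup>2 \<le> 3 * \<rho>\<^sup>2"
    by blast
  then show ?thesis
  proof cases
    case 1
    with x y obtain q where "norm (q - z) < \<rho>" "cball q (\<rho> / 10) \<subseteq> ball x \<rho> \<inter> ball y \<rho>"
      using ball_overlap_midpoint[OF \<open>0 < \<rho>\<close>] by blast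
    with x y have "i \<noteq> j \<and> cball q (\<rho> / 10) \<subseteq> ball (c i) (r i) \<inter> ball (c j) (r j)"
      using \<open>i \<noteq> j\<close> by blast
    then show ?thesis using \<open>norm (q - z) < \<rho>\<close> by blast
  next
    case 2
    with w y obtain q where "norm (q - z) < \<rho>" "cball q (\<rho> / 10) \<subseteq> ball y \<rho> \<inter> ball w \<rho>"
      using ball_overlap_midpoint[OF \<open>0 < \<rho>\<close>] by blast
    with w y have "j \<noteq> k \<and> cball q (\<rho> / 10) \<subseteq> ball (c j) (r j) \<inter> ball (c k) (r k)"
      using \<open>j \<noteq> k\<close> by blast
    then show ?thesis using \<open>norm (q - z) < \<rho>\<close> by blast
  next
    case 3
    with w x obtain q where "norm (q - z) < \<rho>" "cball q (\<rho> / 10) \<subseteq> ball x \<rho> \<inter> ball w \<rho>"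
      using ball_overlap_midpoint[OF \<open>0 < \<rho>\<close>] by blast
    with w x have "i \<noteq> k \<and> cball q (\<rho> / 10) \<subseteq> ball (c i) (r i) \<inter> ball (c k) (r k)"
      using \<open>i \<noteq> k\<close> by blast
    then show ?thesis using \<open>norm (q - z) < \<rho>\<close> by blast
  qed
qed

text \<open>In the coordinate \<open>w\<close> the three points become 1, i and -i, and their
  triangle contains the disc of radius 1/10 about 2/5.\<close>

lemma half_disc_hull:
  fixes u c :: complex
  assumes "norm u = 1" "0 < r" "convex S"
    "c + of_real r * u \<in> S" "c + of_real r * \<i> * u \<in> S" "c - of_real r * \<i> * u \<in> S"
  shows "cball (c + of_real (2 / 5 * r) * u) (r / 10) \<subseteq> S"
proof
  fix z assume z: "z \<in> cball (c + of_real (2 / 5 * r) * u) (r / 10)"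
  have "u \<noteq> 0" using assms by auto
  define w where "w = (z - c) / (of_real r * u)"
  have "w - of_real (2 / 5) = (z - (c + of_real (2 / 5 * r) * u)) / (of_real r * u)"
    using \<open>u \<noteq> 0\<close> assms by (simp add: w_def field_simps)
  then have "norm (w - of_real (2 / 5)) = dist (c + of_real (2 / 5 * r) * u) z / r"
    using assms(1,2) by (simp add: norm_divide norm_mult dist_norm norm_minus_commute)
  also have "\<dots> \<le> 1 / 10"
    using z \<open>0 < r\<close> by (simp add: field_simps)
  finally have "norm (w - of_real (2 / 5)) \<le> 1 / 10" .
  then have w: "\<bar>Re w - 2 / 5\<bar> \<le> 1 / 10" "\<bar>Im w\<bar> \<le> 1 / 10"
    using abs_Re_le_cmod[of "w - of_real (2 / 5)"] abs_Im_le_cmod[of "w - of_real (2 / 5)"] by auto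
  have w: "0 \<le> Re w" "Re w \<le> 1 / 2" "- (1 / 10) \<le> Im w" "Im w \<le> 1 / 10"
    using w by linarith+
  \<comment> \<open>Barycentric coordinates of \<open>w\<close> with respect to 1, i and -i.\<close>
  define A where "A = (\<lambda>n::nat. if n = 0 then Re w else if n = 1 then (1 - Re w + Im w) / 2 else (1 - Re w - Im w) / 2)"
  define P where "P = (\<lambda>n::nat. if n = 0 then c + of_real r * u else if n = 1 then c + of_real r * \<i> * u else c - of_real r * \<i> * u)"
  have "(\<Sum>n<3. A n *\<^sub>R P n) \<in> S"
  proof (rule convex_sum)
    show "sum A {..<3} = 1" by (simp add: A_def numeral_3_eq_3 field_simps)
    show "0 \<le> A n" for n using w by (simp add: A_def)
    show "P n \<in> S" for n using assms by (simp add: P_def)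
  qed (use assms in auto)
  also have "(\<Sum>n<3. A n *\<^sub>R P n) = c + of_real r * u * w"
    by (subst (3) complex_eq) (simp add: A_def P_def numeral_3_eq_3 scaleR_conv_of_real field_simps)
  also have "\<dots> = z"
    using \<open>u \<noteq> 0\<close> assms by (simp add: w_def)
  finally show "z \<in> S" .
qed


text \<open>If there were no such overlap far out, no far point would lie in three of the discs, so the far
  half of the boundary circle of a disc would be covered by disjoint open sets, hence by a single other
  disc. That disc would contain the convex hull of the half circle.\<close>

lemma far_overlap:
  fixes c :: "'i \<Rightarrow> complex"
  assumes "0 < \<rho>" and r: "\<And>i. i \<in> I \<Longrightarrow> \<rho> \<le> r i"
    and cover: "\<And>z. R0 \<le> norm z \<Longrightarrow> \<exists>i\<in>I. z \<in> ball (c i) (r i)"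
  shows "\<exists>a\<in>I. \<exists>b\<in>I. a \<noteq> b \<and>
    (\<exists>q. R1 < norm q \<and> cball q (\<rho> / 10) \<subseteq> ball (c a) (r a) \<inter> ball (c b) (r b))"
proof (rule ccontr)
  assume neg: "\<not> ?thesis"
  \<comment> \<open>The summand \<rho> allows for an overlap centre up to \<rho> closer to the
    origin than the triple point.\<close>
  define R2 where "R2 = max R0 (max R1 0) + \<rho>"
  have R2: "R0 \<le> R2" "R1 \<le> R2 - \<rho>" "0 < R2" using \<open>0 < \<rho>\<close> by (auto simp: R2_def)
  have no_triple: False
    if triple: "i \<in> I" "j \<in> I" "k \<in> I" "i \<noteq> j" "i \<noteq> k" "j \<noteq> k" "R2 < norm z"
      "z \<in> ball (c i) (r i)" "z \<in> ball (c j) (r j)" "z \<in> ball (c k) (r k)" for i j k z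
  proof -
    obtain a b q where ab: "a \<in> {i, j, k}" "b \<in> {i, j, k}" "a \<noteq> b" and q: "norm (q - z) < \<rho>"
      "cball q (\<rho> / 10) \<subseteq> ball (c a) (r a) \<inter> ball (c b) (r b)"
      using triple_point_overlap[OF \<open>0 < \<rho>\<close> r[OF triple(1)] r[OF triple(2)] r[OF triple(3)]
          triple(8-10,4-6)] by metis
    have "norm z \<le> norm q + norm (q - z)" by (metis norm_minus_commute norm_triangle_sub)
    then have "R1 < norm q" using q(1) R2 \<open>R2 < norm z\<close> by linarith
    moreover have "a \<in> I" "b \<in> I" using ab that by auto
    ultimately show False using neg ab q(2) by blast
  qed
  \<comment> \<open>A disc reaching this far has l + r > 10 R2, so the half of its circle facing
    away from the origin lies beyond R2, whether the disc is large or merely distant.\<close>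
  obtain i where i: "i \<in> I" "of_real (10 * R2) \<in> ball (c i) (r i)"
    using cover[of "of_real (10 * R2)"] R2 by auto
  define l where "l = norm (c i)"
  have "0 \<le> l" "0 < r i" using r[OF i(1)] \<open>0 < \<rho>\<close> by (auto simp: l_def)
  have big: "10 * R2 < l + r i"
    using i(2) norm_triangle_sub[of "of_real (10 * R2)" "c i"] R2
    by (simp add: l_def dist_norm norm_minus_commute)
  obtain u where u: "norm u = 1" "c i = of_real l * u"
  proof (cases "c i = 0")
    case False
    then show ?thesis using that[of "sgn (c i)"] by (simp add: l_def norm_sgn) (simp add: sgn_eq)
  qed (use that[of 1] in \<open>simp add: l_def\<close>)
  define \<gamma> where "\<gamma> = (\<lambda>t. c i + of_real (r i) * u * cis t)"
  have \<gamma>_far: "R2 < norm (\<gamma> t)" if "t \<in> {-pi/2..pi/2}" for t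
  proof -
    \<comment> \<open>As cos t is nonnegative here, |\<gamma> t|^2 \<ge> l^2 + r^2 \<ge> (l + r)^2 /
      2 > 50 R2^2.\<close>
    have "0 \<le> cos t" using that by (intro cos_ge_zero) auto
    have "\<gamma> t = u * (of_real l + of_real (r i) * cis t)" by (simp add: \<gamma>_def u(2) algebra_simps)
    then have "(norm (\<gamma> t))\<^sup>2 = (l + r i * cos t)\<^sup>2 + (r i * sin t)\<^sup>2"
      using u(1) by (simp add: norm_mult cmod_power2)
    also have "\<dots> = l\<^sup>2 + (r i)\<^sup>2 * ((sin t)\<^sup>2 + (cos t)\<^sup>2) + 2 * l * r i * cos t"
      unfolding power2_eq_square by (simp only: algebra_simps)
    finally have "l\<^sup>2 + (r i)\<^sup>2 \<le> (norm (\<gamma> t))\<^sup>2"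
      using \<open>0 \<le> l\<close> \<open>0 < r i\<close> \<open>0 \<le> cos t\<close> by simp
    moreover have "(l + r i)\<^sup>2 \<le> 2 * (l\<^sup>2 + (r i)\<^sup>2)"
      using zero_le_power2[of "l - r i"] by (simp add: power2_eq_square algebra_simps)
    moreover have "(10 * R2)\<^sup>2 < (l + r i)\<^sup>2" using big R2 by (intro power_strict_mono) auto
    moreover have "0 < R2\<^sup>2" "(10 * R2)\<^sup>2 = 100 * R2\<^sup>2" using R2 by (auto simp: power2_eq_square)
    ultimately have "R2\<^sup>2 < (norm (\<gamma> t))\<^sup>2" by (smt (verit))
    then show ?thesis by (rule power_less_imp_less_base) simp
  qed
  have \<gamma>_sphere: "dist (c i) (\<gamma> t) = r i" for t
    using u(1) \<open>0 < r i\<close> by (simp add: \<gamma>_def dist_norm norm_mult)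
  define A where "A = \<gamma> ` {-pi/2..pi/2}"
  have "connected A" unfolding A_def \<gamma>_def
    by (intro connected_continuous_image continuous_intros) simp
  have "0 \<in> {-pi/2..pi/2}" by simp
  then have "R2 < norm (\<gamma> 0)" by (rule \<gamma>_far)
  then obtain j where j: "j \<in> I" "\<gamma> 0 \<in> ball (c j) (r j)"
    using cover[of "\<gamma> 0"] R2 by auto
  have "i \<noteq> j" using j \<gamma>_sphere[of 0] by auto
  define V where "V = (\<Union>k\<in>I - {i, j}. ball (c k) (r k))"
  have "open V" by (auto simp: V_def)
  have "A \<subseteq> ball (c j) (r j) \<union> V"
  proof
    fix z assume "z \<in> A"
    then obtain t where t: "t \<in> {-pi/2..pi/2}" "z = \<gamma> t" by (auto simp: A_def)
    then obtain k where "k \<in> I" "z \<in> ball (c k) (r k)"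
      using cover[of z] \<gamma>_far[of t] R2 by auto
    moreover have "k \<noteq> i" using calculation \<gamma>_sphere[of t] t by auto
    ultimately show "z \<in> ball (c j) (r j) \<union> V" by (auto simp: V_def)
  qed
  moreover have "ball (c j) (r j) \<inter> V \<inter> A = {}"
  proof (rule ccontr)
    assume "ball (c j) (r j) \<inter> V \<inter> A \<noteq> {}"
    then obtain y where "y \<in> A" "y \<in> V" "y \<in> ball (c j) (r j)" by blast
    then obtain t k where t: "t \<in> {-pi/2..pi/2}" and k: "k \<in> I - {i, j}"
      and in_both: "\<gamma> t \<in> ball (c j) (r j)" "\<gamma> t \<in> ball (c k) (r k)"
      unfolding A_def V_def by blast
    \<comment> \<open>The point \<gamma> t is only on the boundary of disc \<open>i\<close>, but its
      open neighbourhood \<open>W\<close> meets that disc and gives a genuine triple point.\<close>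
    define W where "W = ball (c j) (r j) \<inter> ball (c k) (r k) \<inter> {z. R2 < norm z}"
    have "open W" unfolding W_def by (intro open_Int open_ball open_Collect_less continuous_intros)
    moreover have "\<gamma> t \<in> W" using in_both \<gamma>_far[OF t] by (simp add: W_def)
    moreover have "\<gamma> t \<in> closure (ball (c i) (r i))"
      using \<gamma>_sphere[of t] \<open>0 < r i\<close> by simp
    ultimately obtain z where "z \<in> W" "z \<in> ball (c i) (r i)"
      by (metis IntE closure_iff_nhds_not_empty disjoint_iff subset_refl)
    then show False
      using no_triple[of i j k z] i j k \<open>i \<noteq> j\<close> by (auto simp: W_def)
  qed
  ultimately have "ball (c j) (r j) \<inter> A = {} \<or> V \<inter> A = {}"
    using connectedD[OF \<open>connected A\<close> open_ball \<open>open V\<close>] by blast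
  moreover have "\<gamma> 0 \<in> ball (c j) (r j) \<inter> A" using j \<open>0 \<in> _\<close> by (auto simp: A_def)
  ultimately have "A \<subseteq> ball (c j) (r j)"
    using \<open>A \<subseteq> _\<close> by blast
  moreover have "\<gamma> 0 \<in> A" "\<gamma> (pi/2) \<in> A" "\<gamma> (-pi/2) \<in> A"
    unfolding A_def by (intro imageI; simp)+
  ultimately have "\<gamma> 0 \<in> ball (c j) (r j)" "\<gamma> (pi/2) \<in> ball (c j) (r j)" "\<gamma> (-pi/2) \<in> ball (c j) (r j)"
    by blast+
  moreover have "\<gamma> 0 = c i + of_real (r i) * u" "\<gamma> (pi/2) = c i + of_real (r i) * \<i> * u"
    "\<gamma> (-pi/2) = c i - of_real (r i) * \<i> * u"
    by (simp_all add: \<gamma>_def complex_eq_iff)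
  ultimately have hull: "cball (c i + of_real (2 / 5 * r i) * u) (r i / 10) \<subseteq> ball (c j) (r j)"
    using half_disc_hull[OF u(1) \<open>0 < r i\<close> convex_ball, of "c i"] by simp
  define q where "q = c i + of_real (2 / 5 * r i) * u"
  have "cball q (\<rho> / 10) \<subseteq> cball q (r i / 10)"
    using r[OF i(1)] by (intro subset_cball) simp
  then have "cball q (\<rho> / 10) \<subseteq> ball (c j) (r j)" using hull by (simp add: q_def)
  moreover have "dist q (c i) = 2 / 5 * r i"
    using u(1) \<open>0 < r i\<close> by (simp add: q_def dist_norm norm_mult)
  then have "cball q (\<rho> / 10) \<subseteq> ball (c i) (r i)"
    using r[OF i(1)] \<open>0 < r i\<close> by (simp add: cball_subset_ball_iff)
  moreover have "q = of_real (l + 2 / 5 * r i) * u" by (simp add: q_def u(2) algebra_simps)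
  then have "norm q = l + 2 / 5 * r i"
    using u(1) \<open>0 \<le> l\<close> \<open>0 < r i\<close> by (simp add: norm_mult del: of_real_add)
  then have "R1 < norm q" using big R2 \<open>0 \<le> l\<close> \<open>0 < \<rho>\<close> by simp
  ultimately show False using neg i(1) j(1) \<open>i \<noteq> j\<close> by blast
qed

text \<open>Overlap centres are chosen one after another with moduli growing by more than \<rho>,
  which exceeds twice the radius \<rho> / 10.\<close>

lemma disjoint_overlaps:
  fixes c :: "'i \<Rightarrow> complex"
  assumes "0 < \<rho>" and r: "\<And>i. i \<in> I \<Longrightarrow> \<rho> \<le> r i"
    and cover: "\<And>z. R0 \<le> norm z \<Longrightarrow> \<exists>i\<in>I. z \<in> ball (c i) (r i)"
  obtains a b :: "nat \<Rightarrow> 'i" and q :: "nat \<Rightarrow> complex"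
  where "\<And>n. a n \<in> I" "\<And>n. b n \<in> I" "\<And>n. a n \<noteq> b n"
    "\<And>n. cball (q n) (\<rho> / 10) \<subseteq> ball (c (a n)) (r (a n)) \<inter> ball (c (b n)) (r (b n))"
    "\<And>m n. m \<noteq> n \<Longrightarrow> cball (q m) (\<rho> / 10) \<inter> cball (q n) (\<rho> / 10) = {}"
proof -
  define P where "P = (\<lambda>q. \<exists>a\<in>I. \<exists>b\<in>I. a \<noteq> b \<and>
    cball q (\<rho> / 10) \<subseteq> ball (c a) (r a) \<inter> ball (c b) (r b))"
  have far: "\<exists>q. P q \<and> R < norm q" for R
  proof -
    obtain a b q where "a \<in> I" "b \<in> I" "a \<noteq> b" "R < norm q"
      "cball q (\<rho> / 10) \<subseteq> ball (c a) (r a) \<inter> ball (c b) (r b)"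
      using far_overlap[where ?R1.0 = R and ?R0.0 = R0 and I = I and c = c and r = r, OF \<open>0 < \<rho>\<close>]
        r cover by blast
    then show ?thesis unfolding P_def by blast
  qed
  have "\<exists>q. \<forall>n::nat. P (q n) \<and> norm (q n) + \<rho> < norm (q (Suc n))"
    using far by (intro dependent_nat_choice) blast+
  then obtain q :: "nat \<Rightarrow> complex" where q: "\<And>n. P (q n)" "\<And>n. norm (q n) + \<rho> < norm (q (Suc n))"
    by blast
  have gap: "norm (q m) + \<rho> < norm (q n)" if "m < n" for m n
    using that
  proof (induction n rule: less_induct)
    case (less n)
    then obtain k where k: "n = Suc k" by (cases n) auto
    show ?case
    proof (cases "m = k")
      case False
      then have "norm (q m) + \<rho> < norm (q k)" using less k by simp
      then show ?thesis using q(2)[of k] k \<open>0 < \<rho>\<close> by simp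
    qed (use q(2) k in simp)
  qed
  have disj: "cball (q m) (\<rho> / 10) \<inter> cball (q n) (\<rho> / 10) = {}" if "m < n" for m n
  proof (rule ccontr)
    assume "\<not> ?thesis"
    then obtain z where "dist (q m) z \<le> \<rho> / 10" "dist (q n) z \<le> \<rho> / 10" by auto
    then have "dist (q n) (q m) \<le> \<rho> / 10 + \<rho> / 10" using dist_triangle2[of "q n" "q m" z] by linarith
    then show False
      using gap[OF that] norm_triangle_sub[of "q n" "q m"] \<open>0 < \<rho>\<close> by (simp add: dist_norm)
  qed
  obtain a b where "\<forall>n. a n \<in> I \<and> b n \<in> I \<and> a n \<noteq> b n \<and>
      cball (q n) (\<rho> / 10) \<subseteq> ball (c (a n)) (r (a n)) \<inter> ball (c (b n)) (r (b n))"
    using q(1) unfolding P_def Bex_def by metis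
  then show ?thesis
    using that[of a b q] disj by (metis inf_commute linorder_neqE_nat)
qed

section \<open>The contradiction on large discs\<close>

lemma eventually_powr_bound:
  fixes v a b C d :: real
  assumes "0 < v" "a < b"
  shows "\<forall>\<^sub>F R in at_top. C * (R powr a * R powr - b * d) < v"
proof -
  have "((\<lambda>R. R powr (a - b)) \<longlongrightarrow> 0) at_top"
    using assms(2) by (intro tendsto_neg_powr filterlim_ident) simp
  then have "((\<lambda>R. C * (R powr (a - b) * d)) \<longlongrightarrow> C * (0 * d)) at_top"
    by (intro tendsto_intros)
  then have "\<forall>\<^sub>F R in at_top. C * (R powr (a - b) * d) < v"
    using assms(1) by (intro order_tendstoD) auto
  then show ?thesis by (simp add: powr_add[symmetric])
qed

theorem theorem1p8:
  fixes \<alpha> :: real and X :: "(complex \<times> nat) set"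
  assumes "\<alpha> > 0"
    and "divisor X"
    and "\<exists>K. compact K \<and> (\<Union>(l, m)\<in>X. ball l (sqrt (real m / \<alpha>))) = UNIV - K"
  shows "\<not> zero_divisor \<alpha> X"
proof
  assume "zero_divisor \<alpha> X"
  moreover have "(\<lambda>z. 0) \<in> fock_infinity \<alpha> \<inter> (\<Inter>(l, m)\<in>X. vanishing_subspace \<alpha> l m)"
    by (auto simp: vanishing_subspace_def fock_infinity_def)
  ultimately obtain f where f: "f \<in> fock_infinity \<alpha>" "\<And>p. p \<in> X \<Longrightarrow> f \<in> vanishing_subspace \<alpha> (fst p) (snd p)"
    and "f \<noteq> (\<lambda>z. 0)"
    unfolding zero_divisor_def by fastforce
  from \<open>f \<noteq> (\<lambda>z. 0)\<close> obtain x where "f x \<noteq> 0" by (auto simp: fun_eq_iff)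
  have hol: "f holomorphic_on UNIV" using f(1) by (simp add: fock_infinity_def)
  obtain C where C: "\<And>z. norm (f z) * exp (- (\<alpha> / 2) * (norm z)\<^sup>2) \<le> C"
    using f(1) by (auto simp: fock_infinity_def bdd_above_def)
  define r where "r = (\<lambda>p :: complex \<times> nat. sqrt (real (snd p) / \<alpha>))"
  define \<rho> where "\<rho> = sqrt (1 / \<alpha>)"
  have "0 < \<rho>" using \<open>\<alpha> > 0\<close> by (simp add: \<rho>_def)
  have m: "1 \<le> snd p" if "p \<in> X" for p using \<open>divisor X\<close> that by (auto simp: divisor_def)
  have r: "\<rho> \<le> r p" if "p \<in> X" for p
    unfolding \<rho>_def r_def using m[OF that] \<open>\<alpha> > 0\<close> by (simp add: divide_right_mono)
  have rm: "\<alpha> * (r p)\<^sup>2 = real (snd p)" for p using \<open>\<alpha> > 0\<close> by (simp add: r_def)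
  have inj: "inj_on fst X"
    using \<open>divisor X\<close> unfolding divisor_def single_valued_def inj_on_def by (metis prod.collapse)
  have zeros: "\<exists>h. h holomorphic_on UNIV \<and> (\<forall>z. f z = (z - fst p) ^ snd p * h z)" if "p \<in> X" for p
    using f(2)[OF that] hol by (intro entire_factor_order) (auto simp: vanishing_subspace_def)
  obtain K where "compact K" and K: "(\<Union>p\<in>X. ball (fst p) (r p)) = UNIV - K"
    using assms(3) by (auto simp: r_def case_prod_beta)
  obtain R0 where R0: "0 < R0" "\<And>z. z \<in> K \<Longrightarrow> norm z < R0"
    using bounded_pos_less[of K] compact_imp_bounded[OF \<open>compact K\<close>] by blast
  have cover: "\<exists>p\<in>X. z \<in> ball (fst p) (r p)" if "R0 \<le> norm z" for z
  proof -
    have "z \<in> UNIV - K" using R0(2)[of z] that by auto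
    then show ?thesis unfolding K[symmetric] by blast
  qed
  define s where "s = \<rho> / 10"
  have "0 < s" using \<open>0 < \<rho>\<close> by (simp add: s_def)
  obtain a b :: "nat \<Rightarrow> complex \<times> nat" and q where ab: "\<And>n. a n \<in> X" "\<And>n. b n \<in> X" "\<And>n. a n \<noteq> b n"
    and q: "\<And>n. cball (q n) s \<subseteq> ball (fst (a n)) (r (a n)) \<inter> ball (fst (b n)) (r (b n))"
    and disj: "\<And>m n. m \<noteq> n \<Longrightarrow> cball (q m) s \<inter> cball (q n) s = {}"
    unfolding s_def using disjoint_overlaps[OF \<open>0 < \<rho>\<close> r cover] by metis
  \<comment> \<open>The negative mass \<alpha> L s^2 on \<open>L\<close> small discs outweighs the
    mass \<alpha> R0^2 added about the origin.\<close>
  obtain L :: nat where "R0\<^sup>2 < real L * s\<^sup>2"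
    using ex_less_of_nat_mult[of "s\<^sup>2" "R0\<^sup>2"] \<open>0 < s\<close> by auto
  then have "\<alpha> * R0\<^sup>2 < \<alpha> * (real L * s\<^sup>2)" using \<open>\<alpha> > 0\<close> by simp
  define w where "w = (\<lambda>z. swept \<alpha> 0 R0 z * (\<Prod>i<L. inverse (swept \<alpha> (q i) s z)))"
  have w_pos: "0 < w z" for z
    unfolding w_def using swept_pos[OF R0(1)] swept_pos[OF \<open>0 < s\<close>] by (simp add: prod_pos)
  \<comment> \<open>\<open>v\<close> depends neither on the radius \<open>R\<close> nor on the
    finite set \<open>F\<close> chosen below.\<close>
  define v where "v = norm (f x) * w x * exp (- (\<alpha> / 2) * (norm x)\<^sup>2)"
  have "0 < v" using \<open>f x \<noteq> 0\<close> w_pos by (simp add: v_def)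
  \<comment> \<open>On the circle of radius \<open>R\<close> each distance to a \<open>q i\<close>
    is only known to be at least R / 2; each of the \<open>L\<close> factors therefore costs
    2^(\<alpha> s^2).\<close>
  define D where "D = 2 powr (\<alpha> * (real L * s\<^sup>2))"
  have "\<forall>\<^sub>F R in at_top. norm x < R \<and> R0 < R \<and> (\<forall>i\<in>{..<L}. 2 * norm (q i) < R) \<and>
      C * (R powr (\<alpha> * R0\<^sup>2) * R powr - (\<alpha> * (real L * s\<^sup>2)) * D) < v"
    using eventually_powr_bound[OF \<open>0 < v\<close> \<open>\<alpha> * R0\<^sup>2 < \<alpha> * (real L * s\<^sup>2)\<close>]
    by (intro eventually_conj eventually_gt_at_top eventually_ball_finite ballI) auto
  then obtain R where R: "norm x < R" "R0 < R" "\<And>i. i < L \<Longrightarrow> 2 * norm (q i) < R"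
    and Rv: "C * (R powr (\<alpha> * R0\<^sup>2) * R powr - (\<alpha> * (real L * s\<^sup>2)) * D) < v"
    using eventually_happens'[OF trivial_limit_at_top_linorder] by (metis (mono_tags, lifting) lessThan_iff)
  \<comment> \<open>Compactness of the annulus reduces the sweeping to finitely many zeros.\<close>
  have "compact (cball 0 R - ball (0::complex) R0)" by (intro compact_diff) auto
  moreover have "cball 0 R - ball 0 R0 \<subseteq> (\<Union>p\<in>X. ball (fst p) (r p))" using cover by auto
  ultimately obtain F0 where F0: "F0 \<subseteq> X" "finite F0" "cball 0 R - ball 0 R0 \<subseteq> (\<Union>p\<in>F0. ball (fst p) (r p))"
    using compactE_image[of "cball 0 R - ball 0 R0" X "\<lambda>p. ball (fst p) (r p)"] open_ball by metis
  \<comment> \<open>Both discs over each small disc are included: one is to cancel the weight, the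
    other the negative density.\<close>
  define F where "F = F0 \<union> a ` {..<L} \<union> b ` {..<L}"
  have F: "F \<subseteq> X" "finite F" using F0 ab by (auto simp: F_def)
  have rF: "0 < r p" if "p \<in> F" for p using r[of p] F(1) that \<open>0 < \<rho>\<close> by force
  obtain g where g: "g holomorphic_on UNIV" "\<And>z. f z = g z * (\<Prod>p\<in>F. (z - fst p) ^ snd p)"
    and gC: "\<And>z. norm (g z) * (\<Prod>p\<in>F. swept \<alpha> (fst p) (r p) z) * exp (- (\<alpha> / 2) * (norm z)\<^sup>2) \<le> C"
    using swept_bound[of \<alpha> F fst r snd f C, OF \<open>\<alpha> > 0\<close> F(2) inj_on_subset[OF inj F(1)] rF rm hol
        zeros[OF subsetD[OF F(1)]] C] by blast
  define V where "V = (\<lambda>z. norm (g z) * (\<Prod>p\<in>F. swept \<alpha> (fst p) (r p) z) * exp (- (\<alpha> / 2) * (norm z)\<^sup>2) * w z)"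
  have "V x \<le> C * (R powr (\<alpha> * R0\<^sup>2) * R powr - (\<alpha> * (real L * s\<^sup>2)) * D)"
  proof (rule hol_minorized_max_principle[of "ball 0 R"])
    have "swept \<alpha> (q i) s z \<noteq> 0" for i z using swept_pos[OF \<open>0 < s\<close>, of \<alpha> "q i" z] by simp
    then show "continuous_on UNIV V"
      unfolding V_def w_def using rF g(1) R0(1) \<open>0 < s\<close>
      by (intro continuous_intros continuous_on_swept holomorphic_on_imp_continuous_on) auto
  next
    fix z :: complex assume "z \<in> frontier (ball 0 R)"
    then have z: "norm z = R" using R0 R by simp
    have "inverse (swept \<alpha> (q i) s z) \<le> R powr - (\<alpha> * s\<^sup>2) * 2 powr (\<alpha> * s\<^sup>2)" if "i < L" for i
    proof -
      have "R / 2 \<le> norm (z - q i)" using norm_triangle_ineq2[of z "q i"] R(3)[OF that] z by simp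
      then have "(R / 2) powr (\<alpha> * s\<^sup>2) \<le> norm (z - q i) powr (\<alpha> * s\<^sup>2)"
        using \<open>\<alpha> > 0\<close> R R0 by (intro powr_mono2) auto
      also have "\<dots> \<le> swept \<alpha> (q i) s z" by (intro powr_le_swept \<open>\<alpha> > 0\<close> \<open>0 < s\<close>)
      finally have "inverse (swept \<alpha> (q i) s z) \<le> inverse ((R / 2) powr (\<alpha> * s\<^sup>2))"
        using R R0 by (intro le_imp_inverse_le) auto
      then show ?thesis using R R0 by (simp add: powr_divide powr_minus field_simps)
    qed
    then have "(\<Prod>i<L. inverse (swept \<alpha> (q i) s z)) \<le> (\<Prod>i<L. R powr - (\<alpha> * s\<^sup>2) * 2 powr (\<alpha> * s\<^sup>2))"
      using swept_pos[OF \<open>0 < s\<close>, THEN less_imp_le] by (intro prod_mono) auto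
    also have "\<dots> = R powr - (\<alpha> * (real L * s\<^sup>2)) * D"
      using R R0 by (simp add: D_def power_mult_distrib powr_powr mult_ac flip: powr_realpow)
    finally have "w z \<le> R powr (\<alpha> * R0\<^sup>2) * R powr - (\<alpha> * (real L * s\<^sup>2)) * D"
      unfolding w_def mult.assoc using swept_outside[of R0 z 0 \<alpha>] R R0 z by (simp add: mult_left_mono)
    moreover have "0 \<le> C"
      by (rule order_trans[OF _ C[of 0]]) simp
    ultimately show "V z \<le> C * (R powr (\<alpha> * R0\<^sup>2) * R powr - (\<alpha> * (real L * s\<^sup>2)) * D)"
      unfolding V_def using gC[of z] w_pos[of z] by (intro mult_mono) auto
  next
    fix z :: complex assume "z \<in> ball 0 R"
    have g_min: "hol_minorized (\<lambda>z. norm (g z)) z" using g(1) by (rule hol_minorized_norm)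
    have F_min: "hol_minorized (\<lambda>z. \<Prod>p\<in>G. swept \<alpha> (fst p) (r p) z) z" if "G \<subseteq> F" for G
      using that rF \<open>\<alpha> > 0\<close> by (intro hol_minorized_prod hol_minorized_swept) auto
    show "hol_minorized V z"
    proof (cases "\<exists>n<L. z \<in> cball (q n) s")
      case True
      then obtain n where n: "n < L" "z \<in> cball (q n) s" by blast
      then have z: "z \<in> ball (fst (a n)) (r (a n))" "z \<in> ball (fst (b n)) (r (b n))"
        using q[of n] by blast+
      \<comment> \<open>Disc \<open>a n\<close> absorbs the weight and disc \<open>b n\<close> the
        inverse factor of index \<open>n\<close>. By disjointness \<open>z\<close> lies outside the
        other small discs, where their inverse factors are harmless.\<close>
      define G where "G = F - {a n, b n}"
      have F_eq: "F = insert (a n) (insert (b n) G)" "a n \<notin> insert (b n) G" "b n \<notin> G" "finite G"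
        using n(1) ab(3)[of n] F(2) by (auto simp: G_def F_def)
      have "n \<in> {..<L}" using n by simp
      have "z \<notin> cball (q i) s" if "i \<in> {..<L} - {n}" for i
        using disj[of i n] that n(2) by blast
      then have "hol_minorized (\<lambda>z. norm (g z) * (\<Prod>p\<in>G. swept \<alpha> (fst p) (r p) z) * swept \<alpha> 0 R0 z *
          (\<Prod>i\<in>{..<L} - {n}. inverse (swept \<alpha> (q i) s z)) *
          (swept \<alpha> (fst (a n)) (r (a n)) z * exp (- (\<alpha> / 2) * (norm z)\<^sup>2)) *
          (swept \<alpha> (fst (b n)) (r (b n)) z * inverse (swept \<alpha> (q n) s z))) z"
        using g(1) rF R0(1) \<open>0 < s\<close> \<open>\<alpha> > 0\<close> z n(2)
        by (intro hol_minorized_mult hol_minorized_norm hol_minorized_prod hol_minorized_swept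
            hol_minorized_swept_gaussian hol_minorized_inverse_swept hol_minorized_swept_quotient)
          (auto simp: G_def)
      also have "(\<lambda>z. norm (g z) * (\<Prod>p\<in>G. swept \<alpha> (fst p) (r p) z) * swept \<alpha> 0 R0 z *
          (\<Prod>i\<in>{..<L} - {n}. inverse (swept \<alpha> (q i) s z)) *
          (swept \<alpha> (fst (a n)) (r (a n)) z * exp (- (\<alpha> / 2) * (norm z)\<^sup>2)) *
          (swept \<alpha> (fst (b n)) (r (b n)) z * inverse (swept \<alpha> (q n) s z))) = V"
        unfolding V_def w_def F_eq(1) prod.remove[OF finite_lessThan \<open>n \<in> {..<L}\<close>] using F_eq(2-4)
        by (simp add: mult_ac)
      finally show ?thesis .
    next
      case False
      then have inv: "hol_minorized (\<lambda>z. \<Prod>i<L. inverse (swept \<alpha> (q i) s z)) z"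
        using \<open>0 < s\<close> by (intro hol_minorized_prod hol_minorized_inverse_swept) auto
      show ?thesis
      \<comment> \<open>Near the origin, where \<open>K\<close> may leave points uncovered, the
        factor \<open>swept \<alpha> 0 R0\<close> absorbs the weight; farther out a disc from
        \<open>F0\<close> does.\<close>
      proof (cases "z \<in> ball 0 R0")
        case True
        show ?thesis
          using hol_minorized_mult[OF hol_minorized_mult[OF hol_minorized_mult[OF g_min F_min[OF order_refl]]
            hol_minorized_swept_gaussian[OF True, of \<alpha>]] inv]
          by (simp add: V_def w_def mult_ac)
      next
        case False
        then have "z \<in> cball 0 R - ball 0 R0" using \<open>z \<in> ball 0 R\<close> by simp
        then have "z \<in> (\<Union>p\<in>F0. ball (fst p) (r p))" by (rule subsetD[OF F0(3)])
        then obtain p where p: "p \<in> F" "z \<in> ball (fst p) (r p)" unfolding F_def by blast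
        show ?thesis
          using hol_minorized_mult[OF hol_minorized_mult[OF hol_minorized_mult[OF
            hol_minorized_mult[OF g_min F_min[OF Diff_subset]] hol_minorized_swept_gaussian[OF p(2), of \<alpha>]]
            hol_minorized_swept[OF \<open>\<alpha> > 0\<close> R0(1), of 0]] inv]
          unfolding V_def w_def prod.remove[OF F(2) p(1)] by (simp add: mult_ac)
      qed
    qed
  qed (use R in auto)
  moreover have "v \<le> V x"
  proof -
    have "norm (f x) = norm (g x) * (\<Prod>p\<in>F. norm (x - fst p) ^ snd p)"
      by (simp add: g(2) norm_mult norm_power flip: prod_norm)
    also have "\<dots> \<le> norm (g x) * (\<Prod>p\<in>F. swept \<alpha> (fst p) (r p) x)"
      using norm_power_le_swept[OF \<open>\<alpha> > 0\<close> rF rm] by (intro mult_left_mono prod_mono) auto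
    finally have "norm (f x) * (w x * exp (- (\<alpha> / 2) * (norm x)\<^sup>2)) \<le>
        norm (g x) * (\<Prod>p\<in>F. swept \<alpha> (fst p) (r p) x) * (w x * exp (- (\<alpha> / 2) * (norm x)\<^sup>2))"
      using w_pos[of x] by (intro mult_right_mono) auto
    then show ?thesis by (simp add: v_def V_def mult_ac)
  qed
  ultimately show False using Rv by linarith
qed

end
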